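(* Let $H(t)$ be a continuous family of Hermitian matrices, let $t_j<t_{j+1}$ and $\Delta t=t_{j+1}-t_j$. Let $U_{\mathrm{exact}}(t_{j+1},t_j)=\mathcal{T}e^{-i\int_{t_j}^{t_{j+1}}H(s)\,ds}$ be the exact propagator and let $U_2(t_{j+1},t_j)=e^{\Omega_2(t_{j+1},t_j)}$ with $$\Omega_2(t_{j+1},t_j)=-i\int_{t_j}^{t_{j+1}}H(s)\,ds+\frac12\int_{t_j}^{t_{j+1}}\left[\int_{t_j}^{s}H(\sigma)\,d\sigma,\,H(s)\right]ds .$$ If $$\sup_{\sigma,s,t\in[t_j,t_{j+1}]}\left\|\left[[H(\sigma),H(s)],H(t)\right]\right\|\le\alpha^j_{\mathrm{comm}},$$ $$\sup_{\sigma,s,t,\tau\in[t_j,t_{j+1}]}\left\|\left[[H(\sigma),H(s)],[H(\tau),H(t)]\right]\right\|\le\beta^j_{\mathrm{comm}},$$ then $$\left\|U_{\mathrm{exact}}(t_{j+1},t_j)-U_2(t_{j+1},t_j)\right\|\le\frac{13}{24}\Delta t^3\,\alpha^j_{\mathrm{comm}}+\frac{5}{48}\Delta t^4\,\beta^j_{\mathrm{comm}} .$$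
   Context: $\|\cdot\|$ is the operator (spectral) norm and $[X,Y]=XY-YX$. The time-ordered exponential $U_{\mathrm{exact}}(t,t_j)=\mathcal{T}e^{-i\int_{t_j}^{t}H(s)ds}$ is the unique solution of $\partial_tU(t,t_j)=-iH(t)U(t,t_j)$, $U(t_j,t_j)=I$. The superscript $j$ in $\alpha^j_{\mathrm{comm}},\beta^j_{\mathrm{comm}}$ is an index of the time interval, not a power. *)

theory Defs
  imports "HOL-Analysis.Analysis"
begin

text \<open>
  Square complex matrices are elements of \<open>complex^'n^'n\<close>. The class operations \<open>*\<close> and \<open>^\<close>
  on this type are entrywise, so \<open>**\<close> and a separate matrix power are used instead. The class
  norm is the Frobenius norm; it enters only through the topology (limits, continuity,
  derivatives, integrals), which in finite dimension is the topology of the operator norm.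
  The norm on \<open>complex^'n\<close> is Euclidean, so the operator norm below is the spectral norm.
\<close>

definition op_norm :: "complex^'n^'n \<Rightarrow> real" where
  "op_norm A = onorm (\<lambda>x. A *v x)"

definition hermitian :: "complex^'n^'n \<Rightarrow> bool" where
  "hermitian A \<longleftrightarrow> (\<forall>i j. A $ i $ j = cnj (A $ j $ i))"

definition commutator :: "complex^'n^'n \<Rightarrow> complex^'n^'n \<Rightarrow> complex^'n^'n" where
  "commutator X Y = X ** Y - Y ** X"

definition cscale :: "complex \<Rightarrow> complex^'n^'n \<Rightarrow> complex^'n^'n"  (infixr \<open>*\<^sub>C\<close> 75) where
  "c *\<^sub>C A = (\<chi> i j. c * A $ i $ j)"

primrec mat_power :: "complex^'n^'n \<Rightarrow> nat \<Rightarrow> complex^'n^'n" where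
  "mat_power A 0 = mat 1"
| "mat_power A (Suc k) = A ** mat_power A k"

definition mat_exp :: "complex^'n^'n \<Rightarrow> complex^'n^'n" where
  "mat_exp A = (\<Sum>k. (1 / fact k) *\<^sub>R mat_power A k)"

definition solves_propagator_ode ::
  "(real \<Rightarrow> complex^'n^'n) \<Rightarrow> real \<Rightarrow> real \<Rightarrow> (real \<Rightarrow> complex^'n^'n) \<Rightarrow> bool" where
  "solves_propagator_ode H t0 t1 U \<longleftrightarrow>
     U t0 = mat 1 \<and>
     (\<forall>t\<in>{t0..t1}. (U has_vector_derivative (- \<i>) *\<^sub>C (H t ** U t)) (at t within {t0..t1}))"

text \<open>
  The time-ordered exponential, for \<open>t0 \<le> t1\<close>. A solution is determined only on \<open>{t0..t1}\<close>, hence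
  the description operator selects its value at \<open>t1\<close>; well-definedness is shown below.
\<close>

definition U_exact :: "(real \<Rightarrow> complex^'n^'n) \<Rightarrow> real \<Rightarrow> real \<Rightarrow> complex^'n^'n" where
  "U_exact H t1 t0 = (THE V. \<exists>U. solves_propagator_ode H t0 t1 U \<and> U t1 = V)"

definition Omega2 :: "(real \<Rightarrow> complex^'n^'n) \<Rightarrow> real \<Rightarrow> real \<Rightarrow> complex^'n^'n" where
  "Omega2 H t1 t0 =
     (- \<i>) *\<^sub>C integral {t0..t1} H
     + (1/2) *\<^sub>R integral {t0..t1} (\<lambda>s. commutator (integral {t0..s} H) (H s))"

definition U2 :: "(real \<Rightarrow> complex^'n^'n) \<Rightarrow> real \<Rightarrow> real \<Rightarrow> complex^'n^'n" where
  "U2 H t1 t0 = mat_exp (Omega2 H t1 t0)"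


subsection \<open>Well-definedness of the matrix exponential and of the propagator\<close>

lemma bounded_bilinear_matrix_mult:
  "bounded_bilinear (\<lambda>(A::complex^'n^'n) (B::complex^'n^'n). A ** B)"
proof -
  have "bilinear (\<lambda>(A::complex^'n^'n) (B::complex^'n^'n). A ** B)"
    unfolding bilinear_def linear_iff
    by (auto simp: matrix_matrix_mult_def vec_eq_iff algebra_simps sum.distrib scaleR_sum_right)
  then show ?thesis by (simp add: bilinear_conv_bounded_bilinear)
qed

lemma bounded_linear_cscale: "bounded_linear (\<lambda>A::complex^'n^'n. c *\<^sub>C A)"
proof -
  have "linear (\<lambda>A::complex^'n^'n. c *\<^sub>C A)"
    unfolding linear_iff cscale_def by (auto simp: vec_eq_iff algebra_simps)
  then show ?thesis by (simp add: linear_conv_bounded_linear)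
qed

lemma summable_mat_exp: "summable (\<lambda>k. (1 / fact k) *\<^sub>R mat_power (A::complex^'n^'n) k)"
proof -
  obtain K where K: "K > 0"
    "\<And>(X::complex^'n^'n) (Y::complex^'n^'n). norm (X ** Y) \<le> norm X * norm Y * K"
    using bounded_bilinear.pos_bounded[OF bounded_bilinear_matrix_mult] by blast
  have pow: "norm (mat_power A k) \<le> norm (mat 1 :: complex^'n^'n) * (norm A * K) ^ k" for k
  proof (induction k)
    case (Suc k)
    have "norm (mat_power A (Suc k)) \<le> norm A * K * norm (mat_power A k)"
      using K(2)[of A "mat_power A k"] by (simp add: algebra_simps)
    also have "\<dots> \<le> norm A * K * (norm (mat 1 :: complex^'n^'n) * (norm A * K) ^ k)"
      using K(1) Suc by (intro mult_left_mono) auto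
    finally show ?case by (simp add: algebra_simps)
  qed simp
  have "summable (\<lambda>k. norm (mat 1 :: complex^'n^'n) * ((norm A * K) ^ k /\<^sub>R fact k))"
    by (intro summable_mult summable_exp_generic)
  then show ?thesis
  proof (rule summable_comparison_test[rotated], intro exI allI impI)
    fix k
    have "norm ((1 / fact k) *\<^sub>R mat_power A k) = norm (mat_power A k) / fact k" by simp
    also have "\<dots> \<le> norm (mat 1 :: complex^'n^'n) * (norm A * K) ^ k / fact k"
      using pow by (intro divide_right_mono) auto
    finally show "norm ((1 / fact k) *\<^sub>R mat_power A k)
        \<le> norm (mat 1 :: complex^'n^'n) * ((norm A * K) ^ k /\<^sub>R fact k)"
      by (simp add: field_simps)
  qed
qed

locale linear_ode =
  fixes F :: "real \<Rightarrow> 'a::euclidean_space \<Rightarrow> 'a" and a b M :: real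
  assumes ab: "a \<le> b"
    and lin: "\<And>t. linear (F t)"
    and M0: "M \<ge> 0"
    and M: "\<And>t x. t \<in> {a..b} \<Longrightarrow> norm (F t x) \<le> M * norm x"
    and cont: "\<And>u. continuous_on {a..b} u \<Longrightarrow> continuous_on {a..b} (\<lambda>t. F t (u t))"
begin

lemma int: "continuous_on {a..b} u \<Longrightarrow> t \<in> {a..b} \<Longrightarrow> (\<lambda>s. F s (u s)) integrable_on {a..t}"
  by (intro integrable_continuous_real continuous_on_subset[OF cont]) auto

lemma iterate_bound:
  assumes W: "\<And>k. continuous_on {a..b} (W k)"
    and step: "\<And>k t. t \<in> {a..b} \<Longrightarrow> W (Suc k) t = integral {a..t} (\<lambda>s. F s (W k s))"
    and base: "\<And>t. t \<in> {a..b} \<Longrightarrow> norm (W 0 t) \<le> C"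
    and t: "t \<in> {a..b}"
  shows "norm (W k t) \<le> C * (M * (t - a)) ^ k / fact k"
  using t
proof (induction k arbitrary: t)
  case 0
  then show ?case using base by simp
next
  case (Suc k)
  have hi: "((\<lambda>s. C * M ^ Suc k * (s - a) ^ k / fact k) has_integral
      C * M ^ Suc k * (t - a) ^ Suc k / fact (Suc k)
      - C * M ^ Suc k * (a - a) ^ Suc k / fact (Suc k)) {a..t}"
  proof (rule fundamental_theorem_of_calculus)
    fix x assume "x \<in> {a..t}"
    have "((\<lambda>s. (s - a) ^ Suc k) has_real_derivative real (Suc k) * (1 * (x - a) ^ k))
        (at x within {a..t})"
      by (rule DERIV_power[where n = "Suc k" and s = "{a..t}", simplified diff_Suc_Suc minus_nat.diff_0])
        (auto intro!: derivative_eq_intros)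
    from DERIV_cmult[OF this, of "C * M ^ Suc k / fact (Suc k)"]
    show "((\<lambda>s. C * M ^ Suc k * (s - a) ^ Suc k / fact (Suc k)) has_vector_derivative
        C * M ^ Suc k * (x - a) ^ k / fact k) (at x within {a..t})"
      by (simp add: has_real_derivative_iff_has_vector_derivative[symmetric] fact_Suc
          mult.assoc del: of_nat_Suc power_Suc)
  qed (use Suc.prems in auto)
  have "norm (integral {a..t} (\<lambda>s. F s (W k s)))
      \<le> integral {a..t} (\<lambda>s. C * M ^ Suc k * (s - a) ^ k / fact k)"
  proof (rule integral_norm_bound_integral)
    show "(\<lambda>s. F s (W k s)) integrable_on {a..t}" using int[OF W Suc.prems] .
    show "(\<lambda>s. C * M ^ Suc k * (s - a) ^ k / fact k) integrable_on {a..t}"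
      using hi by blast
    fix s assume s: "s \<in> {a..t}"
    then have s': "s \<in> {a..b}" using Suc.prems by auto
    have "norm (F s (W k s)) \<le> M * (C * (M * (s - a)) ^ k / fact k)"
      using M[OF s', of "W k s"] mult_left_mono[OF Suc.IH[OF s'] M0] by linarith
    then show "norm (F s (W k s)) \<le> C * M ^ Suc k * (s - a) ^ k / fact k"
      by (simp add: power_mult_distrib mult_ac)
  qed
  also have "\<dots> = C * (M * (t - a)) ^ Suc k / fact (Suc k)"
    using integral_unique[OF hi] by (simp add: power_mult_distrib mult_ac)
  finally show ?case using step[OF Suc.prems] by simp
qed

lemma integral_equation:
  assumes "\<And>t. t \<in> {a..b} \<Longrightarrow> (U has_vector_derivative F t (U t)) (at t within {a..b})"
    and t: "t \<in> {a..b}"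
  shows "U t = U a + integral {a..t} (\<lambda>s. F s (U s))"
proof -
  have "((\<lambda>s. F s (U s)) has_integral (U t - U a)) {a..t}"
    using t by (intro fundamental_theorem_of_calculus)
      (auto intro!: has_vector_derivative_within_subset[OF assms(1)])
  then show ?thesis by (simp add: integral_unique)
qed

lemma unique:
  assumes U: "\<And>t. t \<in> {a..b} \<Longrightarrow> (U has_vector_derivative F t (U t)) (at t within {a..b})"
    and V: "\<And>t. t \<in> {a..b} \<Longrightarrow> (V has_vector_derivative F t (V t)) (at t within {a..b})"
    and init: "U a = V a" and t: "t \<in> {a..b}"
  shows "U t = V t"
proof -
  define D where "D = (\<lambda>t. U t - V t)"
  have DF: "(D has_vector_derivative F t (D t)) (at t within {a..b})" if "t \<in> {a..b}" for t
    using has_vector_derivative_diff[OF U[OF that] V[OF that]] linear_diff[OF lin]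
    by (simp add: D_def)
  have D: "D t = integral {a..t} (\<lambda>s. F s (D s))" if "t \<in> {a..b}" for t
    using integral_equation[of D, OF DF that] init by (simp add: D_def)
  have cD: "continuous_on {a..b} D"
    unfolding continuous_on_eq_continuous_within
    using has_vector_derivative_continuous[OF DF] by blast
  then obtain C where C: "\<And>t. t \<in> {a..b} \<Longrightarrow> norm (D t) \<le> C"
    using compact_imp_bounded[OF compact_continuous_image[OF cD]]
    by (meson bounded_iff compact_Icc imageI)
  have "norm (D t) \<le> C * (M * (t - a)) ^ k / fact k" for k
    using iterate_bound[of "\<lambda>_. D", OF cD D C t] .
  moreover have "(\<lambda>k. C * ((M * (t - a)) ^ k /\<^sub>R fact k)) \<longlonglongrightarrow> C * 0"
    by (intro tendsto_mult tendsto_const summable_LIMSEQ_zero summable_exp_generic)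
  ultimately have "norm (D t) \<le> 0"
    by (intro LIMSEQ_le_const[where X = "\<lambda>k. C * ((M * (t - a)) ^ k /\<^sub>R fact k)"])
      (auto simp: field_simps)
  then show ?thesis by (simp add: D_def)
qed

lemma existence:
  "\<exists>U. U a = x0 \<and> (\<forall>t\<in>{a..b}. (U has_vector_derivative F t (U t)) (at t within {a..b}))"
proof -
  define V where "V = rec_nat (\<lambda>_. x0) (\<lambda>_ v t. integral {a..t} (\<lambda>s. F s (v s)))"
  have V0: "V 0 = (\<lambda>_. x0)"
    and VS: "V (Suc k) = (\<lambda>t. integral {a..t} (\<lambda>s. F s (V k s)))" for k
    by (simp_all add: V_def)
  have cV: "continuous_on {a..b} (V k)" for k
  proof (cases k)
    case 0
    then show ?thesis by (simp add: V0)
  next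
    case (Suc j)
    have "continuous_on {a..b} (V j)"
    proof (induction j)
      case (Suc j)
      then show ?case
        by (auto simp: VS intro!: indefinite_integral_continuous_1 int ab)
    qed (simp add: V0)
    then show ?thesis by (auto simp: Suc VS intro!: indefinite_integral_continuous_1 int ab)
  qed
  have bd: "norm (V k t) \<le> norm x0 * (M * (b - a)) ^ k / fact k" if t: "t \<in> {a..b}" for k t
  proof -
    have "norm (V k t) \<le> norm x0 * (M * (t - a)) ^ k / fact k"
      using iterate_bound[of V, OF cV _ _ t] by (simp add: V0 VS)
    also have "\<dots> \<le> norm x0 * (M * (b - a)) ^ k / fact k"
      using t M0 by (intro divide_right_mono mult_left_mono power_mono) auto
    finally show ?thesis .
  qed
  define S where "S = (\<lambda>n t. \<Sum>k<n. V k t)"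
  define U where "U = (\<lambda>t. \<Sum>k. V k t)"
  have "summable (\<lambda>k. norm x0 * ((M * (b - a)) ^ k /\<^sub>R fact k))"
    by (intro summable_mult summable_exp_generic)
  then have sm: "summable (\<lambda>k. norm x0 * (M * (b - a)) ^ k / fact k)"
    by (simp add: field_simps)
  have ul: "uniform_limit {a..b} S U sequentially"
    unfolding S_def U_def using bd sm by (rule Weierstrass_m_test)
  have cS: "continuous_on {a..b} (S n)" for n
    unfolding S_def by (intro continuous_intros cV)
  have cU: "continuous_on {a..b} U"
    by (rule uniform_limit_theorem[OF _ ul]) (auto simp: cS)
  have SS: "S (Suc n) t = x0 + integral {a..t} (\<lambda>s. F s (S n s))" if t: "t \<in> {a..b}" for n t
  proof -
    have "S (Suc n) t = V 0 t + (\<Sum>k<n. V (Suc k) t)"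
      unfolding S_def by (rule sum.lessThan_Suc_shift)
    also have "(\<Sum>k<n. V (Suc k) t) = integral {a..t} (\<lambda>s. \<Sum>k<n. F s (V k s))"
      unfolding VS by (rule integral_sum[symmetric]) (auto intro: int cV t)
    also have "(\<lambda>s. \<Sum>k<n. F s (V k s)) = (\<lambda>s. F s (S n s))"
      by (simp add: S_def linear_sum[OF lin])
    finally show ?thesis by (simp add: V0)
  qed
  have Ueq: "U t = x0 + integral {a..t} (\<lambda>s. F s (U s))" if t: "t \<in> {a..b}" for t
  proof -
    have "uniform_limit {a..t} (\<lambda>n s. F s (S n s)) (\<lambda>s. F s (U s)) sequentially"
    proof (rule uniform_limitI)
      fix e :: real assume e: "e > 0"
      have "\<forall>\<^sub>F n in sequentially. \<forall>s\<in>{a..b}. dist (S n s) (U s) < e / (M + 1)"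
        using uniform_limitD[OF ul, of "e / (M + 1)"] e M0 by simp
      then show "\<forall>\<^sub>F n in sequentially. \<forall>s\<in>{a..t}. dist (F s (S n s)) (F s (U s)) < e"
      proof (rule eventually_mono, intro ballI)
        fix n s assume n: "\<forall>s\<in>{a..b}. dist (S n s) (U s) < e / (M + 1)" and "s \<in> {a..t}"
        then have s: "s \<in> {a..b}" using t by auto
        have "dist (F s (S n s)) (F s (U s)) \<le> M * dist (S n s) (U s)"
          using M[OF s, of "S n s - U s"] by (simp add: dist_norm linear_diff[OF lin])
        also have "\<dots> \<le> (M + 1) * dist (S n s) (U s)"
          by (intro mult_right_mono) auto
        also have "\<dots> < e" using n s M0 by (simp add: field_simps)
        finally show "dist (F s (S n s)) (F s (U s)) < e" .
      qed
    qed
    then obtain I J where IJ: "\<And>n. ((\<lambda>s. F s (S n s)) has_integral I n) {a..t}"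
      "((\<lambda>s. F s (U s)) has_integral J) {a..t}" "I \<longlonglongrightarrow> J"
      by (rule uniform_limit_integral)
        (auto intro!: continuous_on_subset[OF cont[OF cS]] 
          order_trans[OF _ t[unfolded atLeastAtMost_iff, THEN conjunct2]])
    moreover have "I = (\<lambda>n. integral {a..t} (\<lambda>s. F s (S n s)))"
      
      using integral_unique[OF IJ(1)] by (simp add: fun_eq_iff)
    ultimately have "(\<lambda>n. integral {a..t} (\<lambda>s. F s (S n s))) \<longlonglongrightarrow> integral {a..t} (\<lambda>s. F s (U s))"
      using integral_unique[OF IJ(2)] IJ(3) by simp
    then have "(\<lambda>n. S (Suc n) t) \<longlonglongrightarrow> x0 + integral {a..t} (\<lambda>s. F s (U s))"
      unfolding SS[OF t] by (intro tendsto_add tendsto_const)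
    moreover have "(\<lambda>n. S (Suc n) t) \<longlonglongrightarrow> U t"
      using tendsto_uniform_limitI[OF ul t] by (rule LIMSEQ_Suc)
    ultimately show ?thesis using LIMSEQ_unique by blast
  qed
  have "(U has_vector_derivative F t (U t)) (at t within {a..b})" if t: "t \<in> {a..b}" for t
  proof -
    have "((\<lambda>t. x0 + integral {a..t} (\<lambda>s. F s (U s))) has_vector_derivative 0 + F t (U t))
        (at t within {a..b})"
      by (intro has_vector_derivative_add has_vector_derivative_const
          integral_has_vector_derivative[OF cont[OF cU] t])
    then have "((\<lambda>t. x0 + integral {a..t} (\<lambda>s. F s (U s))) has_vector_derivative F t (U t))
        (at t within {a..b})" by simp
    then show ?thesis
      by (rule has_vector_derivative_transform[OF t, rotated]) (use Ueq in auto)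
  qed
  moreover have "U a = x0" using Ueq[of a] ab by simp
  ultimately show ?thesis by blast
qed

end

lemma propagator_linear_ode:
  fixes H :: "real \<Rightarrow> complex^'n^'n"
  assumes ab: "a \<le> b" and H: "continuous_on {a..b} H"
  shows "\<exists>M. linear_ode (\<lambda>t X. (- \<i>) *\<^sub>C (H t ** X)) a b M"
proof -
  interpret B: bounded_bilinear "\<lambda>(A::complex^'n^'n) (B::complex^'n^'n). A ** B"
    by (rule bounded_bilinear_matrix_mult)
  interpret C: bounded_linear "\<lambda>A::complex^'n^'n. (- \<i>) *\<^sub>C A"
    by (rule bounded_linear_cscale)
  obtain K where K: "K > 0"
    "\<And>(X::complex^'n^'n) (Y::complex^'n^'n). norm (X ** Y) \<le> norm X * norm Y * K"
    using B.pos_bounded by blast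
  obtain L where L: "L > 0" "\<And>X::complex^'n^'n. norm ((- \<i>) *\<^sub>C X) \<le> norm X * L"
    using C.pos_bounded by blast
  obtain h where h: "h > 0" "\<And>t. t \<in> {a..b} \<Longrightarrow> norm (H t) \<le> h"
    using compact_imp_bounded[OF compact_continuous_image[OF H]]
    by (auto simp: bounded_pos)
  show ?thesis
  proof (rule exI[of _ "h * K * L"], rule linear_ode.intro)
    show "a \<le> b" by (rule ab)
    show "linear (\<lambda>X. (- \<i>) *\<^sub>C (H t ** X))" for t
      by (rule linearI) (simp_all add: B.add_right C.add B.scaleR_right C.scaleR)
    show "h * K * L \<ge> 0" using h K L by simp
    show "norm ((- \<i>) *\<^sub>C (H t ** X)) \<le> h * K * L * norm X" if t: "t \<in> {a..b}" for t X
    proof -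
      have "norm ((- \<i>) *\<^sub>C (H t ** X)) \<le> norm (H t ** X) * L" by (rule L(2))
      also have "\<dots> \<le> (norm (H t) * norm X * K) * L"
        using K(2) L(1) by (intro mult_right_mono) auto
      also have "\<dots> \<le> (h * norm X * K) * L"
        using h(2)[OF t] K(1) L(1) by (intro mult_right_mono) auto
      finally show ?thesis by (simp add: algebra_simps)
    qed
    show "continuous_on {a..b} (\<lambda>t. (- \<i>) *\<^sub>C (H t ** u t))" if "continuous_on {a..b} u" for u
      by (intro C.continuous_on B.continuous_on H that)
  qed
qed

lemma ex_solves_propagator_ode:
  assumes "t0 \<le> t1" "continuous_on {t0..t1} H"
  shows "\<exists>U. solves_propagator_ode H t0 t1 U"
proof -
  obtain M where "linear_ode (\<lambda>t X. (- \<i>) *\<^sub>C (H t ** X)) t0 t1 M"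
    using propagator_linear_ode[OF assms] by blast
  from linear_ode.existence[OF this, of "mat 1"] show ?thesis
    by (auto simp: solves_propagator_ode_def)
qed

lemma solves_propagator_ode_unique:
  assumes "continuous_on {t0..t1} H" "solves_propagator_ode H t0 t1 U"
    "solves_propagator_ode H t0 t1 V" and t: "t \<in> {t0..t1}"
  shows "U t = V t"
proof -
  have "t0 \<le> t1" using t by auto
  then obtain M where "linear_ode (\<lambda>t X. (- \<i>) *\<^sub>C (H t ** X)) t0 t1 M"
    using propagator_linear_ode[OF _ assms(1)] by blast
  from linear_ode.unique[OF this, of U V t] show ?thesis
    using assms(2,3) t by (auto simp: solves_propagator_ode_def)
qed

lemma U_exact_eqI:
  assumes "t0 \<le> t1" "continuous_on {t0..t1} H" "solves_propagator_ode H t0 t1 U"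
  shows "U_exact H t1 t0 = U t1"
  unfolding U_exact_def
proof (rule the_equality)
  show "\<exists>U'. solves_propagator_ode H t0 t1 U' \<and> U' t1 = U t1" using assms(3) by blast
  fix V assume "\<exists>U'. solves_propagator_ode H t0 t1 U' \<and> U' t1 = V"
  then show "V = U t1"
    using solves_propagator_ode_unique[OF assms(2) _ assms(3), of _ t1] assms(1) by auto
qed

text \<open>Restricting a solution shows that the propagators from \<open>t0\<close> form one trajectory.\<close>

lemma U_exact_solves:
  assumes "t0 \<le> t1" "continuous_on {t0..t1} H"
  shows "solves_propagator_ode H t0 t1 (\<lambda>t. U_exact H t t0)"
proof -
  obtain U where U: "solves_propagator_ode H t0 t1 U"
    using ex_solves_propagator_ode[OF assms] by blast
  have eq: "U_exact H t t0 = U t" if t: "t \<in> {t0..t1}" for t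
  proof (rule U_exact_eqI)
    show "continuous_on {t0..t} H" by (rule continuous_on_subset[OF assms(2)]) (use t in auto)
    show "solves_propagator_ode H t0 t U"
      using U t unfolding solves_propagator_ode_def
      by (auto intro: has_vector_derivative_within_subset[of _ _ _ "{t0..t1}"])
  qed (use t in auto)
  show ?thesis
    unfolding solves_propagator_ode_def
  proof (intro conjI ballI)
    show "U_exact H t0 t0 = mat 1"
      using eq[of t0] assms(1) U by (simp add: solves_propagator_ode_def)
    fix t assume t: "t \<in> {t0..t1}"
    have "(U has_vector_derivative (- \<i>) *\<^sub>C (H t ** U_exact H t t0)) (at t within {t0..t1})"
      using U t eq[OF t] by (simp add: solves_propagator_ode_def)
    then show "((\<lambda>t. U_exact H t t0) has_vector_derivative
        (- \<i>) *\<^sub>C (H t ** U_exact H t t0)) (at t within {t0..t1})"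
      by (rule has_vector_derivative_transform[OF t, rotated]) (use eq in auto)
  qed
qed

end

theory Submission
  imports Defs
begin

text \<open>
  Put \<open>A = -iH\<close>, \<open>I t = \<integral>H\<close>, \<open>G = [I, H]\<close> and \<open>K t = \<integral>G\<close> (integrals from \<open>a\<close> to \<open>t\<close>), so that
  \<open>\<Omega> = -iI + K/2\<close> and \<open>\<Omega>' = A + G/2\<close>. Then \<open>U2' = B ** U2\<close>, where \<open>B = b 1\<close> for the solution of
  \<open>b' = \<Omega>' + [\<Omega>, b]\<close>, \<open>b 0 = 0\<close>. The path \<open>q y = y A + (y - y\<^sup>2)/2 G\<close> ends at \<open>A\<close> and satisfies this
  equation up to \<open>y/2 [K, A] + (y - y\<^sup>2)/2 [\<Omega>, G]\<close>; these are exactly the commutators which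
  \<open>\<alpha>\<close> and \<open>\<beta>\<close> control, with no nesting of higher order. Hence \<open>U2\<close> solves the propagator equation
  up to a defect of size \<open>\<alpha> (t-a)\<^sup>2 + \<beta>/4 (t-a)\<^sup>3\<close>. Since all generators are skew-Hermitian, defects
  enter the solution only additively, and integration gives the constants \<open>1/3\<close> and \<open>1/16\<close>, which
  are smaller than the claimed ones.
\<close>

section \<open>Bilinear products of matrices and complex scaling\<close>

interpretation matmul: bounded_bilinear "\<lambda>(A::complex^'n^'n) (B::complex^'n^'n). A ** B"
  by (rule bounded_bilinear_matrix_mult)

lemmas linear_cscale = bounded_linear.linear[OF bounded_linear_cscale]

interpretation matvec: bounded_bilinear "\<lambda>(A::complex^'n^'n) (x::complex^'n). A *v x"
proof -
  have "bilinear (\<lambda>(A::complex^'n^'n) (x::complex^'n). A *v x)"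
    unfolding bilinear_def linear_iff
    by (auto simp: matrix_vector_mult_def vec_eq_iff algebra_simps sum.distrib scaleR_sum_right)
  then show "bounded_bilinear (\<lambda>(A::complex^'n^'n) (x::complex^'n). A *v x)"
    by (simp add: bilinear_conv_bounded_bilinear)
qed

interpretation commutator: bounded_bilinear "commutator :: complex^'n^'n \<Rightarrow> _ \<Rightarrow> _"
proof -
  have "bilinear (commutator :: complex^'n^'n \<Rightarrow> _ \<Rightarrow> _)"
    unfolding bilinear_def linear_iff commutator_def
    by (auto simp: matmul.add_left matmul.add_right matmul.scaleR_left matmul.scaleR_right
        scaleR_diff_right)
  then show "bounded_bilinear (commutator :: complex^'n^'n \<Rightarrow> _ \<Rightarrow> _)"
    by (simp add: bilinear_conv_bounded_bilinear)
qed

lemma cscale_matmul_left: "(c *\<^sub>C A) ** B = c *\<^sub>C (A ** B)"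
  and cscale_matmul_right: "A ** (c *\<^sub>C B) = c *\<^sub>C (A ** B)"
  by (auto simp: cscale_def matrix_matrix_mult_def vec_eq_iff sum_distrib_left mult_ac)

lemma cscale_commutator_left: "commutator (c *\<^sub>C A) B = c *\<^sub>C commutator A B"
  and cscale_commutator_right: "commutator A (c *\<^sub>C B) = c *\<^sub>C commutator A B"
  by (simp_all add: commutator_def cscale_matmul_left cscale_matmul_right linear_diff[OF linear_cscale])

lemma commutator_swap: "commutator A B = - commutator B A"
  by (simp add: commutator_def)

section \<open>The operator norm and its equivalence with the class norm\<close>

lemma norm_mult_vec_le: "norm (A *v x) \<le> op_norm A * norm x"
  unfolding op_norm_def by (rule onorm) simp

lemma op_norm_leI: "(\<And>x. norm (A *v x) \<le> b * norm x) \<Longrightarrow> op_norm A \<le> b"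
  unfolding op_norm_def by (rule onorm_le)

lemma op_norm_nonneg [simp]: "0 \<le> op_norm A"
  unfolding op_norm_def by (rule onorm_pos_le) simp

lemma op_norm_add: "op_norm (A + B) \<le> op_norm A + op_norm B"
  unfolding op_norm_def matvec.add_left by (rule onorm_triangle) simp_all

lemma op_norm_scaleR: "op_norm (r *\<^sub>R A) = \<bar>r\<bar> * op_norm A"
  unfolding op_norm_def matvec.scaleR_left by (rule onorm_scaleR) simp

lemma op_norm_zero [simp]: "op_norm 0 = 0"
  using op_norm_scaleR[of 0 0] by simp

lemma op_norm_minus [simp]: "op_norm (- A) = op_norm A"
  using op_norm_scaleR[of "-1" A] by simp

lemma op_norm_diff: "op_norm (A - B) \<le> op_norm A + op_norm B"
  using op_norm_add[of A "- B"] by simp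

lemma op_norm_mult: "op_norm (A ** B) \<le> op_norm A * op_norm B"
proof (rule op_norm_leI)
  fix x
  have "norm (A *v (B *v x)) \<le> op_norm A * (op_norm B * norm x)"
    by (rule order_trans[OF norm_mult_vec_le mult_left_mono[OF norm_mult_vec_le]]) simp
  then show "norm ((A ** B) *v x) \<le> op_norm A * op_norm B * norm x"
    by (simp add: matrix_vector_mul_assoc mult.assoc)
qed

lemma op_norm_commutator: "op_norm (commutator A B) \<le> 2 * op_norm A * op_norm B"
  using op_norm_diff[of "A ** B" "B ** A"] op_norm_mult[of A B] op_norm_mult[of B A]
  by (simp add: commutator_def mult_ac)

text \<open>The Euclidean norm of a vector scaled by \<open>c\<close> depends on \<open>c\<close>
  only through \<open>cmod c\<close>, so the rule for real factors applies.\<close>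

lemma op_norm_cscale: "op_norm (c *\<^sub>C A) = cmod c * op_norm A"
proof -
  have "norm ((c *\<^sub>C A) *v x) = norm (cmod c *\<^sub>R (A *v x))" for x
  proof -
    have "(c *\<^sub>C A) *v x = c *s (A *v x)"
      by (simp add: cscale_def matrix_vector_mult_def vec_eq_iff sum_distrib_left mult_ac)
    then show ?thesis
      by (simp add: norm_vec_def norm_mult L2_set_def power_mult_distrib
          real_sqrt_mult flip: sum_distrib_left)
  qed
  then have "op_norm (c *\<^sub>C A) = op_norm (cmod c *\<^sub>R A)"
    unfolding op_norm_def onorm_def by (simp add: matvec.scaleR_left)
  then show ?thesis by (simp add: op_norm_scaleR)
qed

text \<open>With the converse estimate below, bounds can move between the operator norm, in which
  the errors are estimated, and the class norm, in which derivatives are defined.\<close>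

lemma op_norm_le_norm:
  obtains K where "K > 0" "\<And>A::complex^'n^'n. op_norm A \<le> K * norm A"
proof -
  obtain K where "K > 0" and K: "\<And>(A::complex^'n^'n) x. norm (A *v x) \<le> norm A * norm x * K"
    using matvec.pos_bounded by blast
  have "op_norm A \<le> K * norm A" for A :: "complex^'n^'n"
    by (rule op_norm_leI) (use K in \<open>simp add: mult_ac\<close>)
  with \<open>K > 0\<close> show ?thesis using that by blast
qed

text \<open>Each entry is a coordinate of the image of a unit vector, hence at most the operator
  norm; the class norm is at most the sum of the norms of the \<open>CARD('n) ^ 2\<close>
  entries.\<close>

lemma norm_le_op_norm: "norm A \<le> real (CARD('n)) ^ 2 * op_norm (A::complex^'n^'n)"
proof -
  have e: "norm (A $ i $ j) \<le> op_norm A" for i j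
  proof -
    have "A $ i $ j = (A *v axis j 1) $ i"
      by (simp add: matrix_vector_mult_def axis_def if_distrib cong: if_cong)
    then have "norm (A $ i $ j) \<le> norm (A *v axis j 1)"
      by (simp add: Finite_Cartesian_Product.norm_nth_le)
    also have "\<dots> \<le> op_norm A * norm (axis j (1::complex) :: complex^'n)"
      by (rule norm_mult_vec_le)
    finally show ?thesis by simp
  qed
  have "norm A \<le> (\<Sum>i\<in>UNIV. norm (A $ i))"
    unfolding norm_vec_def[of A] by (rule L2_set_le_sum) simp
  also have "\<dots> \<le> (\<Sum>i\<in>UNIV. \<Sum>j\<in>UNIV. norm (A $ i $ j))"
    unfolding norm_vec_def[of "A $ _"] by (intro sum_mono L2_set_le_sum) simp
  also have "\<dots> \<le> (\<Sum>i\<in>(UNIV::'n set). \<Sum>j\<in>(UNIV::'n set). op_norm A)"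
    by (intro sum_mono e)
  finally show ?thesis by (simp add: power2_eq_square mult_ac)
qed

section \<open>Skew-Hermitian matrices and linear equations generated by them\<close>

text \<open>\<open>inner\<close> on \<open>complex^'n\<close> is the real part of the Hermitian
  inner product. As \<open>S\<close> acts complex linearly, replacing \<open>y\<close> by
  \<open>\<i> y\<close> recovers the imaginary part, so this real condition says that
  \<open>S\<close> is skew-Hermitian.\<close>

definition skew :: "complex^'n^'n \<Rightarrow> bool" where
  "skew S \<longleftrightarrow> (\<forall>x y. inner (S *v x) y = - inner x (S *v y))"

lemma skew_inner_zero: "skew S \<Longrightarrow> inner x (S *v x) = 0"
  unfolding skew_def by (metis equation_minus_iff inner_commute neg_equal_zero)

lemma skew_add: "skew A \<Longrightarrow> skew B \<Longrightarrow> skew (A + B)"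
  by (simp add: skew_def matvec.add_left inner_add)

lemma skew_scaleR: "skew A \<Longrightarrow> skew (r *\<^sub>R A)"
  by (simp add: skew_def matvec.scaleR_left)

lemma skew_commutator: "skew A \<Longrightarrow> skew B \<Longrightarrow> skew (commutator A B)"
  by (simp add: skew_def commutator_def matvec.diff_left inner_diff flip: matrix_vector_mul_assoc)

text \<open>For fixed \<open>x\<close> and \<open>y\<close> the condition is the vanishing of a
  bounded linear functional \<open>L\<close>, and such functionals pass under the integral.\<close>

lemma skew_integral:
  assumes "f integrable_on T" and f: "\<And>t. t \<in> T \<Longrightarrow> skew (f t)"
  shows "skew (integral T f :: complex^'n^'n)"
  unfolding skew_def
proof (intro allI)
  fix x y :: "complex^'n"
  define L where "L = (\<lambda>A. inner (A *v x) y + inner x (A *v y))"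
  have "bounded_linear L"
    unfolding L_def
    by (intro bounded_linear_add bounded_linear_inner_left_comp bounded_linear_inner_right_comp
        matvec.bounded_linear_left)
  then have "L (integral T f) = integral T (\<lambda>t. L (f t))"
    using integral_linear[OF assms(1), of L] by (simp add: o_def)
  also have "\<dots> = integral T (\<lambda>_. 0)"
    by (rule integral_cong) (use f in \<open>simp add: L_def skew_def\<close>)
  finally show "inner (integral T f *v x) y = - inner x (integral T f *v y)"
    by (simp add: L_def)
qed

lemma skew_hermitian:
  assumes "hermitian A"
  shows "skew ((- \<i>) *\<^sub>C A)"
  unfolding skew_def
proof (intro allI)
  fix x y
  \<comment> \<open>Moving \<open>A $ i $ j\<close> to the other argument conjugates it, which
    Hermitian symmetry turns into \<open>A $ j $ i\<close>; conjugating \<open>\<i>\<close> produces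
    the sign.\<close>
  have p: "inner (- (\<i> * (A $ i $ j * x $ j))) (y $ i) = - inner (x $ j) (- (\<i> * (A $ j $ i * y $ i)))"
    for i j
  proof -
    have "A $ j $ i = cnj (A $ i $ j)"
      using assms unfolding hermitian_def by blast
    then show ?thesis by (simp add: inner_complex_def algebra_simps)
  qed
  have "inner (((- \<i>) *\<^sub>C A) *v x) y
      = (\<Sum>i\<in>UNIV. \<Sum>j\<in>UNIV. inner (- (\<i> * (A $ i $ j * x $ j))) (y $ i))"
    by (simp add: inner_vec_def matrix_vector_mult_def cscale_def inner_sum_left mult.assoc)
  also have "\<dots> = (\<Sum>j\<in>UNIV. \<Sum>i\<in>UNIV. - inner (x $ j) (- (\<i> * (A $ j $ i * y $ i))))"
    unfolding p by (rule sum.swap)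
  also have "\<dots> = - inner x (((- \<i>) *\<^sub>C A) *v y)"
    by (simp add: inner_vec_def matrix_vector_mult_def cscale_def inner_sum_right mult.assoc sum_negf)
  finally show "inner (((- \<i>) *\<^sub>C A) *v x) y = - inner x (((- \<i>) *\<^sub>C A) *v y)" .
qed

text \<open>Differentiating \<open>sqrt ((norm (w t))\<^sup>2 + e\<^sup>2)\<close> instead of \<open>norm (w t)\<close> avoids the zeros of \<open>w\<close>.\<close>

lemma skew_ode_norm_le:
  fixes w :: "real \<Rightarrow> 'a::real_inner"
  assumes "a \<le> b"
    and w: "\<And>t. t \<in> {a..b} \<Longrightarrow> (w has_vector_derivative f t (w t) + r t) (at t within {a..b})"
    and skew: "\<And>t x. t \<in> {a..b} \<Longrightarrow> inner x (f t x) = 0"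
    and r: "\<And>t. t \<in> {a..b} \<Longrightarrow> norm (r t) \<le> \<phi>' t"
    and \<phi>: "\<And>t. t \<in> {a..b} \<Longrightarrow> (\<phi> has_real_derivative \<phi>' t) (at t within {a..b})"
  shows "norm (w b) \<le> norm (w a) + (\<phi> b - \<phi> a)"
proof (rule field_le_epsilon)
  fix e :: real assume e: "e > 0"
  define h where "h = (\<lambda>t. sqrt (inner (w t) (w t) + e\<^sup>2))"
  have pos: "inner (w t) (w t) + e\<^sup>2 > 0" for t
    using e by (simp add: add_nonneg_pos)
  have h: "(h has_real_derivative inner (w t) (r t) / h t) (at t within {a..b})"
    if t: "t \<in> {a..b}" for t
  proof -
    have "((\<lambda>t. inner (w t) (w t)) has_vector_derivative
        inner (w t) (f t (w t) + r t) + inner (f t (w t) + r t) (w t)) (at t within {a..b})"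
      by (rule bounded_bilinear.has_vector_derivative[OF bounded_bilinear_inner w[OF t] w[OF t]])
    then have "((\<lambda>t. inner (w t) (w t)) has_real_derivative 2 * inner (w t) (r t)) (at t within {a..b})"
      using skew[OF t, of "w t"]
      by (simp add: has_real_derivative_iff_has_vector_derivative inner_add inner_commute)
    from DERIV_add[OF this DERIV_const[of "e\<^sup>2"]]
    have "((\<lambda>t. inner (w t) (w t) + e\<^sup>2) has_real_derivative 2 * inner (w t) (r t)) (at t within {a..b})"
      by simp
    from DERIV_chain2[OF DERIV_real_sqrt[OF pos] this]
    show ?thesis by (simp add: h_def field_simps)
  qed
  have hw: "norm (w t) \<le> h t" for t
    by (simp add: h_def norm_eq_sqrt_inner)
  have h0: "h t > 0" for t
    using pos by (simp add: h_def)
  \<comment> \<open>By skewness only \<open>r\<close> contributes to the derivative of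
    \<open>h\<close>; Cauchy-Schwarz and \<open>norm (w t) \<le> h t\<close> bound that derivative
    by \<open>\<phi>' t\<close>.\<close>
  have "\<phi> a - h a \<le> \<phi> b - h b"
  proof (rule DERIV_nonneg_imp_increasing_open[OF \<open>a \<le> b\<close>])
    fix t assume t: "a < t" "t < b"
    then have at: "at t within {a..b} = at t"
      by (rule at_within_Icc_at)
    have "inner (w t) (r t) \<le> norm (w t) * norm (r t)"
      by (rule norm_cauchy_schwarz)
    also have "\<dots> \<le> h t * \<phi>' t"
      by (rule mult_mono[OF hw r]) (use t h0[of t] in auto)
    finally have "\<phi>' t - inner (w t) (r t) / h t \<ge> 0"
      using h0[of t] by (simp add: field_simps)
    moreover have "((\<lambda>t. \<phi> t - h t) has_real_derivative \<phi>' t - inner (w t) (r t) / h t) (at t)"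
      using DERIV_diff[OF \<phi> h, of t] t by (simp add: at)
    ultimately show "\<exists>y. ((\<lambda>t. \<phi> t - h t) has_real_derivative y) (at t) \<and> 0 \<le> y"
      by blast
  next
    show "continuous_on {a..b} (\<lambda>t. \<phi> t - h t)"
      by (intro continuous_on_diff DERIV_continuous_on[OF \<phi>] DERIV_continuous_on[OF h])
  qed
  moreover have "h a \<le> norm (w a) + e"
    unfolding h_def by (rule order_trans[OF sqrt_add_le_add_sqrt])
      (use e in \<open>auto simp: norm_eq_sqrt_inner\<close>)
  ultimately show "norm (w b) \<le> norm (w a) + (\<phi> b - \<phi> a) + e"
    using hw[of b] by linarith
qed

text \<open>Each image \<open>W t *v x\<close> of a fixed vector satisfies the vector equation with
  defect \<open>R t *v x\<close>, so the previous estimate applies with \<open>\<phi>\<close> scaled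
  by \<open>norm x\<close>. No exponential growth factor arises.\<close>

lemma skew_ode_op_norm_le:
  assumes "a \<le> b"
    and W: "\<And>t. t \<in> {a..b} \<Longrightarrow> (W has_vector_derivative S t ** W t + R t) (at t within {a..b})"
    and skew: "\<And>t. t \<in> {a..b} \<Longrightarrow> skew (S t)"
    and R: "\<And>t. t \<in> {a..b} \<Longrightarrow> op_norm (R t) \<le> \<phi>' t"
    and \<phi>: "\<And>t. t \<in> {a..b} \<Longrightarrow> (\<phi> has_real_derivative \<phi>' t) (at t within {a..b})"
  shows "op_norm (W b) \<le> op_norm (W a) + (\<phi> b - \<phi> a)"
proof (rule op_norm_leI)
  fix x
  have "norm (W b *v x) \<le> norm (W a *v x) + (\<phi> b * norm x - \<phi> a * norm x)"
  proof (rule skew_ode_norm_le[where f = "\<lambda>t. (*v) (S t)" and r = "\<lambda>t. R t *v x"])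
    fix t assume t: "t \<in> {a..b}"
    show "((\<lambda>t. W t *v x) has_vector_derivative S t *v (W t *v x) + R t *v x) (at t within {a..b})"
      using bounded_linear.has_vector_derivative[OF matvec.bounded_linear_left W[OF t]]
      by (simp add: matvec.add_left matrix_vector_mul_assoc)
    show "inner y (S t *v y) = 0" for y
      using skew[OF t] by (rule skew_inner_zero)
    show "norm (R t *v x) \<le> \<phi>' t * norm x"
      using norm_mult_vec_le mult_right_mono[OF R[OF t]] order_trans norm_ge_zero by blast
    show "((\<lambda>t. \<phi> t * norm x) has_real_derivative \<phi>' t * norm x) (at t within {a..b})"
      by (rule DERIV_cmult_right[OF \<phi>[OF t]])
  qed (rule \<open>a \<le> b\<close>)
  with norm_mult_vec_le[of "W a" x]
  show "norm (W b *v x) \<le> (op_norm (W a) + (\<phi> b - \<phi> a)) * norm x"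
    by (simp add: algebra_simps)
qed

text \<open>Evaluation at a fixed vector reduces the bound to the Euclidean norm. Later
  \<open>L\<close> is built from commutators with fixed matrices, which thereby pass under the
  integral.\<close>

lemma op_norm_integral_le:
  fixes f :: "real \<Rightarrow> complex^'n^'n" and L :: "complex^'n^'n \<Rightarrow> complex^'n^'n"
  assumes "a \<le> b" and f: "continuous_on {a..b} f" and L: "bounded_linear L"
    and B: "\<And>t. t \<in> {a..b} \<Longrightarrow> op_norm (L (f t)) \<le> B"
  shows "op_norm (L (integral {a..b} f)) \<le> B * (b - a)"
proof (rule op_norm_leI)
  fix x
  have M: "bounded_linear (\<lambda>X. L X *v x)"
    by (rule bounded_linear_compose[OF matvec.bounded_linear_left L])
  have "L (integral {a..b} f) *v x = integral {a..b} (\<lambda>t. L (f t) *v x)"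
    using integral_linear[OF integrable_continuous_real[OF f] M] by (simp add: o_def)
  also have "norm \<dots> \<le> (B * norm x) * (b - a)"
  proof (rule integral_bound[OF \<open>a \<le> b\<close>])
    show "continuous_on {a..b} (\<lambda>t. L (f t) *v x)"
      by (rule bounded_linear.continuous_on[OF M f])
    show "norm (L (f t) *v x) \<le> B * norm x" if "t \<in> {a..b}" for t
      using norm_mult_vec_le mult_right_mono[OF B[OF that]] order_trans norm_ge_zero by blast
  qed
  finally show "norm (L (integral {a..b} f) *v x) \<le> B * (b - a) * norm x"
    by (simp add: mult_ac)
qed

section \<open>The matrix exponential: its differential equation and its derivative along a
  curve\<close>

lemma linear_ode_const:
  fixes F :: "'a::euclidean_space \<Rightarrow> 'a"
  assumes "a \<le> b" "bounded_linear F"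
  shows "linear_ode (\<lambda>_. F) a b (onorm F)"
proof (rule linear_ode.intro)
  show "linear F" by (rule bounded_linear.linear[OF assms(2)])
  show "0 \<le> onorm F" by (rule onorm_pos_le[OF assms(2)])
  show "norm (F x) \<le> onorm F * norm x" for x by (rule onorm[OF assms(2)])
  show "continuous_on {a..b} (\<lambda>t. F (u t))" if "continuous_on {a..b} u" for u
    by (rule bounded_linear.continuous_on[OF assms(2) that])
qed (rule assms(1))

lemma mat_exp_zero: "mat_exp (0::complex^'n^'n) = mat 1"
proof -
  have "mat_power (0::complex^'n^'n) (Suc k) = 0" for k
    by (simp add: matmul.zero_left)
  then have "mat_exp (0::complex^'n^'n)
      = (\<Sum>k\<in>{0}. (1 / fact k) *\<^sub>R mat_power (0::complex^'n^'n) k)"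
    unfolding mat_exp_def by (intro suminf_finite) (auto simp: gr0_conv_Suc)
  then show ?thesis by simp
qed

text \<open>The difference between \<open>V\<close> and the partial sums of the exponential series
  arises from \<open>V\<close> by iterated integration against \<open>\<Omega>\<close>, so the
  factorial estimate for iterates forces it to \<open>0\<close> at \<open>y = 1\<close>.\<close>

lemma mat_exp_eq_ode_solution:
  fixes V :: "real \<Rightarrow> complex^'n^'n"
  assumes V0: "V 0 = mat 1"
    and V: "\<And>y. y \<in> {0..1} \<Longrightarrow> (V has_vector_derivative \<Omega> ** V y) (at y within {0..1})"
  shows "V 1 = mat_exp \<Omega>"
proof -
  \<comment> \<open>The sum runs over \<open>j < k\<close>, so \<open>p 0 = 0\<close> and
    \<open>W 0 = V\<close>; differentiating \<open>p (Suc k)\<close> lowers the index by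
    one.\<close>
  define p where "p = (\<lambda>k y. \<Sum>j<k. (y ^ j / fact j) *\<^sub>R mat_power \<Omega> j)"
  define W where "W = (\<lambda>k y. V y - p k y)"
  define M where "M = onorm ((**) \<Omega> :: complex^'n^'n \<Rightarrow> _)"
  interpret L: linear_ode "\<lambda>_. (**) \<Omega> :: complex^'n^'n \<Rightarrow> _" 0 1 M
    unfolding M_def by (intro linear_ode_const matmul.bounded_linear_right) simp
  have p: "(p (Suc k) has_vector_derivative \<Omega> ** p k y) (at y within {0..1})" for k y
  proof -
    have m: "((\<lambda>y. y ^ Suc j / fact (Suc j)) has_vector_derivative y ^ j / fact j)
        (at y within {0..1})" for j
      unfolding has_real_derivative_iff_has_vector_derivative[symmetric]
      by (rule derivative_eq_intros refl | simp add: field_simps del: of_nat_Suc power_Suc)+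
    have "((\<lambda>y. mat 1 + (\<Sum>j<k. (y ^ Suc j / fact (Suc j)) *\<^sub>R mat_power \<Omega> (Suc j)))
        has_vector_derivative 0 + (\<Sum>j<k. (y ^ j / fact j) *\<^sub>R mat_power \<Omega> (Suc j)))
        (at y within {0..1})"
      by (intro has_vector_derivative_add has_vector_derivative_const has_vector_derivative_sum
          bounded_linear.has_vector_derivative[OF bounded_linear_scaleR_left m])
    moreover have "p (Suc k) = (\<lambda>y. mat 1 + (\<Sum>j<k. (y ^ Suc j / fact (Suc j)) *\<^sub>R mat_power \<Omega> (Suc j)))"
      unfolding p_def by (subst sum.lessThan_Suc_shift) simp
    moreover have "0 + (\<Sum>j<k. (y ^ j / fact j) *\<^sub>R mat_power \<Omega> (Suc j)) = \<Omega> ** p k y"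
      by (simp add: p_def matmul.sum_right matmul.scaleR_right)
    ultimately show ?thesis by simp
  qed
  have W: "(W (Suc k) has_vector_derivative \<Omega> ** W k y) (at y within {0..1})"
    if "y \<in> {0..1}" for k y
    using has_vector_derivative_diff[OF V[OF that] p] by (simp add: W_def matmul.diff_right)
  have cV: "continuous_on {0..1} V"
    unfolding continuous_on_eq_continuous_within
    using has_vector_derivative_continuous[OF V] by blast
  then have cW: "continuous_on {0..1} (W k)" for k
    unfolding W_def p_def by (intro continuous_intros) auto
  have step: "W (Suc k) y = integral {0..y} (\<lambda>s. \<Omega> ** W k s)" if y: "y \<in> {0..1}" for k y
  proof -
    have "((\<lambda>s. \<Omega> ** W k s) has_integral (W (Suc k) y - W (Suc k) 0)) {0..y}"
      using y by (intro fundamental_theorem_of_calculus)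
        (auto intro!: has_vector_derivative_within_subset[OF W])
    moreover have "W (Suc k) 0 = 0"
      unfolding W_def p_def V0 by (subst sum.lessThan_Suc_shift) simp
    ultimately show ?thesis by (simp add: integral_unique)
  qed
  obtain C where C: "\<And>y. y \<in> {0..1} \<Longrightarrow> norm (W 0 y) \<le> C"
    using compact_imp_bounded[OF compact_continuous_image[OF cW[of 0]]]
    unfolding bounded_iff by blast
  have bound: "norm (W k 1) \<le> C * (M ^ k /\<^sub>R fact k)" for k
    using L.iterate_bound[of W C 1 k, OF cW step C] by (simp add: field_simps)
  have "(\<lambda>k. C * (M ^ k /\<^sub>R fact k)) \<longlonglongrightarrow> 0"
    by (rule tendsto_mult_right_zero[OF summable_LIMSEQ_zero[OF summable_exp_generic]])
  then have "(\<lambda>k. W k 1) \<longlonglongrightarrow> 0"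
    by (rule Lim_null_comparison[rotated]) (rule always_eventually, rule allI, rule bound)
  then have "(\<lambda>k. V 1 - W k 1) \<longlonglongrightarrow> V 1 - 0"
    by (intro tendsto_diff tendsto_const)
  then have "(\<lambda>k. (1 / fact k) *\<^sub>R mat_power \<Omega> k) sums V 1"
    by (simp add: sums_def W_def p_def)
  then show ?thesis unfolding mat_exp_def by (rule sums_unique)
qed

text \<open>\<open>Z y\<close> is the derivative of \<open>mat_exp (y *\<^sub>R \<Omega> s)\<close> with respect to \<open>s\<close> at \<open>s = t\<close>.\<close>

lemma mat_exp_curve_derivative:
  fixes \<Omega> :: "real \<Rightarrow> complex^'n^'n"
  assumes \<Omega>: "(\<Omega> has_vector_derivative \<Omega>') (at t within T)"
    and skew: "\<And>s. s \<in> T \<Longrightarrow> skew (\<Omega> s)" and t: "t \<in> T"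
  obtains E Z where "E 0 = mat 1" "Z 0 = 0"
    and "\<And>y. y \<in> {0..1} \<Longrightarrow> (E has_vector_derivative \<Omega> t ** E y) (at y within {0..1})"
    and "\<And>y. y \<in> {0..1} \<Longrightarrow>
      (Z has_vector_derivative \<Omega> t ** Z y + \<Omega>' ** E y) (at y within {0..1})"
    and "E 1 = mat_exp (\<Omega> t)"
    and "((\<lambda>s. mat_exp (\<Omega> s)) has_vector_derivative Z 1) (at t within T)"
proof -
  \<comment> \<open>\<open>E\<close> and \<open>Z\<close> solve a joint autonomous linear system, so
    one existence statement on the product space yields both.\<close>
  define F where "F = (\<lambda>X::(complex^'n^'n) \<times> (complex^'n^'n).
    (\<Omega> t ** fst X, \<Omega> t ** snd X + \<Omega>' ** fst X))"
  have F: "bounded_linear F"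
    unfolding F_def
    by (intro bounded_linear_Pair bounded_linear_add
        bounded_linear_compose[OF matmul.bounded_linear_right]
        bounded_linear_fst bounded_linear_snd)
  obtain U where U0: "U 0 = (mat 1, 0)"
    and U: "\<And>y. y \<in> {0..1} \<Longrightarrow> (U has_vector_derivative F (U y)) (at y within {0..1})"
    using linear_ode.existence[OF linear_ode_const[OF _ F, of 0 1], of "(mat 1, 0)"] by auto
  define E where "E = (\<lambda>y. fst (U y))"
  define Z where "Z = (\<lambda>y. snd (U y))"
  have E: "(E has_vector_derivative \<Omega> t ** E y) (at y within {0..1})" if "y \<in> {0..1}" for y
    using bounded_linear.has_vector_derivative[OF bounded_linear_fst U[OF that]]
    by (simp add: E_def F_def)
  have Z: "(Z has_vector_derivative \<Omega> t ** Z y + \<Omega>' ** E y) (at y within {0..1})"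
    if "y \<in> {0..1}" for y
    using bounded_linear.has_vector_derivative[OF bounded_linear_snd U[OF that]]
    by (simp add: E_def Z_def F_def)
  have E0: "E 0 = mat 1" and Z0: "Z 0 = 0"
    by (simp_all add: E_def Z_def U0)
  have E1: "E 1 = mat_exp (\<Omega> t)"
    by (rule mat_exp_eq_ode_solution[OF E0 E])
  obtain K1 where "K1 > 0" and K1: "\<And>A::complex^'n^'n. op_norm A \<le> K1 * norm A"
    using op_norm_le_norm by blast
  have bdd: "\<exists>K. \<forall>y\<in>{0..1}. op_norm (X y) \<le> K"
    if "\<And>y. y \<in> {0..1} \<Longrightarrow> (X has_vector_derivative X' y) (at y within {0..1})"
    for X X' :: "real \<Rightarrow> complex^'n^'n"
  proof -
    have "continuous_on {0..1} X"
      unfolding continuous_on_eq_continuous_within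
      using has_vector_derivative_continuous[OF that] by blast
    then have "bounded (X ` {0..1})"
      by (intro compact_imp_bounded compact_continuous_image) auto
    then obtain C where "\<And>y. y \<in> {0..1} \<Longrightarrow> norm (X y) \<le> C"
      unfolding bounded_iff by blast
    then have "op_norm (X y) \<le> K1 * C" if "y \<in> {0..1}" for y
      using K1[of "X y"] mult_left_mono[of "norm (X y)" C K1] \<open>K1 > 0\<close> that
      by (meson less_imp_le order_trans)
    then show ?thesis by blast
  qed
  obtain KE KZ where K: "\<And>y. y \<in> {0..1} \<Longrightarrow> op_norm (E y) \<le> KE"
      "\<And>y. y \<in> {0..1} \<Longrightarrow> op_norm (Z y) \<le> KZ"
    using bdd[OF E] bdd[OF Z] by blast
  have "0 \<le> KE" "0 \<le> KZ"
    by (auto intro: order_trans[OF op_norm_nonneg K(1)[of 0]] order_trans[OF op_norm_nonneg K(2)[of 0]])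
  \<comment> \<open>The exponential path \<open>V\<close> of \<open>\<Omega> s\<close> is compared
    with the first-order expansion \<open>E + (s - t) Z\<close>, both as paths in \<open>y\<close>;
    skewness of \<open>\<Omega> s\<close> keeps the error below the defect.\<close>
  have main: "op_norm (mat_exp (\<Omega> s) - mat_exp (\<Omega> t) - (s - t) *\<^sub>R Z 1)
      \<le> op_norm (\<Omega> s - \<Omega> t - (s - t) *\<^sub>R \<Omega>') * KE + \<bar>s - t\<bar> * (op_norm (\<Omega> s - \<Omega> t) * KZ)"
    (is "_ \<le> ?c") if s: "s \<in> T" for s
  proof -
    obtain V where V0: "V 0 = mat 1"
      and V: "\<And>y. y \<in> {0..1} \<Longrightarrow> (V has_vector_derivative \<Omega> s ** V y) (at y within {0..1})"
      using linear_ode.existence[OF linear_ode_const[OF _ matmul.bounded_linear_right, of 0 1 "\<Omega> s"], of "mat 1"]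
      by auto
    \<comment> \<open>The defect of \<open>V - E - (s - t) Z\<close> with \<open>\<Omega> s\<close>
      as generator. Its first term is \<open>o(s - t)\<close> by differentiability of
      \<open>\<Omega>\<close> at \<open>t\<close>, its second by continuity.\<close>
    define R where "R = (\<lambda>y. (\<Omega> s - \<Omega> t - (s - t) *\<^sub>R \<Omega>') ** E y
      + (s - t) *\<^sub>R ((\<Omega> s - \<Omega> t) ** Z y))"
    have "op_norm (V 1 - E 1 - (s - t) *\<^sub>R Z 1)
        \<le> op_norm (V 0 - E 0 - (s - t) *\<^sub>R Z 0) + (?c * 1 - ?c * 0)"
    proof (rule skew_ode_op_norm_le[where S = "\<lambda>_. \<Omega> s" and R = R])
      fix y :: real assume y: "y \<in> {0..1}"
      have "((\<lambda>y. V y - E y - (s - t) *\<^sub>R Z y) has_vector_derivative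
          \<Omega> s ** V y - \<Omega> t ** E y - (s - t) *\<^sub>R (\<Omega> t ** Z y + \<Omega>' ** E y)) (at y within {0..1})"
        by (intro has_vector_derivative_diff V E Z y
            bounded_linear.has_vector_derivative[OF bounded_linear_scaleR_right])
      moreover have "\<Omega> s ** V y - \<Omega> t ** E y - (s - t) *\<^sub>R (\<Omega> t ** Z y + \<Omega>' ** E y)
          = \<Omega> s ** (V y - E y - (s - t) *\<^sub>R Z y) + R y"
        unfolding R_def
        by (simp only: matmul.diff_left matmul.diff_right matmul.scaleR_left
            matmul.scaleR_right scaleR_diff_right scaleR_add_right) simp
      ultimately show "((\<lambda>y. V y - E y - (s - t) *\<^sub>R Z y) has_vector_derivative
          \<Omega> s ** (V y - E y - (s - t) *\<^sub>R Z y) + R y) (at y within {0..1})"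
        by simp
      have "op_norm (R y) \<le> op_norm ((\<Omega> s - \<Omega> t - (s - t) *\<^sub>R \<Omega>') ** E y)
          + \<bar>s - t\<bar> * op_norm ((\<Omega> s - \<Omega> t) ** Z y)"
        unfolding R_def by (rule order_trans[OF op_norm_add]) (simp add: op_norm_scaleR)
      also have "\<dots> \<le> ?c"
        by (intro add_mono mult_left_mono order_trans[OF op_norm_mult] K y) auto
      finally show "op_norm (R y) \<le> ?c" .
      show "((\<lambda>y. ?c * y) has_real_derivative ?c) (at y within {0..1})"
        using DERIV_cmult[OF DERIV_ident, of ?c y "{0..1}"] by simp
    qed (use skew s in auto)
    moreover have "V 1 = mat_exp (\<Omega> s)"
      by (rule mat_exp_eq_ode_solution[OF V0 V])
    ultimately show ?thesis by (simp add: E1 V0 E0 Z0)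
  qed
  \<comment> \<open>The derivative is a statement in the class norm; \<open>N\<close> and
    \<open>K1\<close> are the two constants of the norm equivalence.\<close>
  define N where "N = real (CARD('n)) ^ 2"
  have "((\<lambda>s. mat_exp (\<Omega> s)) has_derivative (\<lambda>h. h *\<^sub>R Z 1)) (at t within T)"
  proof (rule has_derivativeI_sandwich[of 1])
    fix s assume s: "s \<in> T" "s \<noteq> t"
    have "norm (mat_exp (\<Omega> s) - mat_exp (\<Omega> t) - (s - t) *\<^sub>R Z 1)
        \<le> N * (op_norm (\<Omega> s - \<Omega> t - (s - t) *\<^sub>R \<Omega>') * KE + \<bar>s - t\<bar> * (op_norm (\<Omega> s - \<Omega> t) * KZ))"
      unfolding N_def by (rule order_trans[OF norm_le_op_norm mult_left_mono[OF main[OF s(1)]]]) simp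
    also have "\<dots> \<le> N * ((K1 * norm (\<Omega> s - \<Omega> t - (s - t) *\<^sub>R \<Omega>')) * KE
        + \<bar>s - t\<bar> * ((K1 * norm (\<Omega> s - \<Omega> t)) * KZ))"
      unfolding N_def using \<open>0 \<le> KE\<close> \<open>0 \<le> KZ\<close>
      by (intro mult_left_mono add_mono mult_right_mono K1) auto
    finally show "norm (mat_exp (\<Omega> s) - mat_exp (\<Omega> t) - (s - t) *\<^sub>R Z 1) / norm (s - t)
        \<le> N * (K1 * (norm (\<Omega> s - \<Omega> t - (s - t) *\<^sub>R \<Omega>') / norm (s - t)) * KE
          + K1 * norm (\<Omega> s - \<Omega> t) * KZ)"
      using s(2) by (simp add: field_simps)
  next
    have "((\<lambda>s. norm (\<Omega> s - \<Omega> t - (s - t) *\<^sub>R \<Omega>') / norm (s - t)) \<longlongrightarrow> 0) (at t within T)"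
      using \<Omega> unfolding has_vector_derivative_def has_derivative_iff_norm by blast
    moreover have "((\<lambda>s. norm (\<Omega> s - \<Omega> t)) \<longlongrightarrow> 0) (at t within T)"
      using has_vector_derivative_continuous[OF \<Omega>]
      by (intro tendsto_norm_zero LIM_zero) (simp add: continuous_within)
    ultimately have "((\<lambda>s. N * (K1 * (norm (\<Omega> s - \<Omega> t - (s - t) *\<^sub>R \<Omega>') / norm (s - t)) * KE
        + K1 * norm (\<Omega> s - \<Omega> t) * KZ)) \<longlongrightarrow> N * (K1 * 0 * KE + K1 * 0 * KZ)) (at t within T)"
      by (intro tendsto_intros)
    then show "((\<lambda>s. N * (K1 * (norm (\<Omega> s - \<Omega> t - (s - t) *\<^sub>R \<Omega>') / norm (s - t)) * KE
        + K1 * norm (\<Omega> s - \<Omega> t) * KZ)) \<longlongrightarrow> 0) (at t within T)"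
      by simp
  qed (auto intro: bounded_linear_scaleR_left)
  then have "((\<lambda>s. mat_exp (\<Omega> s)) has_vector_derivative Z 1) (at t within T)"
    by (simp add: has_vector_derivative_def)
  with E0 Z0 E Z E1 show ?thesis by (rule that[of E Z])
qed

text \<open>If \<open>q\<close> nearly solves \<open>q' = \<Omega>' + [\<Omega>, q]\<close>, then \<open>q y ** E y\<close> nearly solves the equation of \<open>Z y\<close>
  in the previous lemma, so \<open>q 1\<close> nearly is the generator of \<open>mat_exp (\<Omega> s)\<close> at \<open>t\<close>.\<close>

lemma mat_exp_curve_generator:
  fixes \<Omega> q :: "real \<Rightarrow> complex^'n^'n"
  assumes \<Omega>: "(\<Omega> has_vector_derivative \<Omega>') (at t within T)"
    and skew: "\<And>s. s \<in> T \<Longrightarrow> skew (\<Omega> s)" and t: "t \<in> T"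
    and q0: "q 0 = 0"
    and q: "\<And>y. y \<in> {0..1} \<Longrightarrow> (q has_vector_derivative q' y) (at y within {0..1})"
    and B: "\<And>y. y \<in> {0..1} \<Longrightarrow> op_norm (\<Omega>' + commutator (\<Omega> t) (q y) - q' y) \<le> B"
  obtains R where "op_norm R \<le> B"
    and "((\<lambda>s. mat_exp (\<Omega> s)) has_vector_derivative q 1 ** mat_exp (\<Omega> t) + R) (at t within T)"
proof -
  obtain E Z where E0: "E 0 = mat 1" and Z0: "Z 0 = 0"
    and E: "\<And>y. y \<in> {0..1} \<Longrightarrow> (E has_vector_derivative \<Omega> t ** E y) (at y within {0..1})"
    and Z: "\<And>y. y \<in> {0..1} \<Longrightarrow>
      (Z has_vector_derivative \<Omega> t ** Z y + \<Omega>' ** E y) (at y within {0..1})"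
    and E1: "E 1 = mat_exp (\<Omega> t)"
    and D: "((\<lambda>s. mat_exp (\<Omega> s)) has_vector_derivative Z 1) (at t within T)"
    using mat_exp_curve_derivative[OF \<Omega> skew t] by blast
  have "op_norm (mat 1 :: complex^'n^'n) \<le> 1"
    by (rule op_norm_leI) simp
  \<comment> \<open>The comparison estimate with zero defect: the flow of a skew matrix does not
    increase the operator norm.\<close>
  have E_le: "op_norm (E y) \<le> 1" if y: "y \<in> {0..1}" for y
  proof -
    have "op_norm (E y) \<le> op_norm (E 0) + (0 - 0)"
    proof (rule skew_ode_op_norm_le[where S = "\<lambda>_. \<Omega> t" and R = "\<lambda>_. 0" and \<phi>' = "\<lambda>_. 0"])
      fix x assume "x \<in> {0..y}"
      then show "(E has_vector_derivative \<Omega> t ** E x + 0) (at x within {0..y})"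
        using E[of x] y by (auto intro: has_vector_derivative_within_subset)
    qed (use y skew t in auto)
    also have "\<dots> \<le> 1" using E0 \<open>op_norm (mat 1 :: complex^'n^'n) \<le> 1\<close> by simp
    finally show ?thesis .
  qed
  define \<rho> where "\<rho> = (\<lambda>y. \<Omega>' + commutator (\<Omega> t) (q y) - q' y)"
  have "0 \<le> B"
    by (rule order_trans[OF op_norm_nonneg B[of 0]]) simp
  have "op_norm (Z 1 - q 1 ** E 1) \<le> op_norm (Z 0 - q 0 ** E 0) + (B * 1 - B * 0)"
  proof (rule skew_ode_op_norm_le[where S = "\<lambda>_. \<Omega> t" and R = "\<lambda>y. \<rho> y ** E y"])
    fix y :: real assume y: "y \<in> {0..1}"
    have "((\<lambda>y. Z y - q y ** E y) has_vector_derivative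
        \<Omega> t ** Z y + \<Omega>' ** E y - (q y ** (\<Omega> t ** E y) + q' y ** E y)) (at y within {0..1})"
      by (intro has_vector_derivative_diff Z matmul.has_vector_derivative q E y)
    \<comment> \<open>Adding and subtracting \<open>\<Omega> t ** (q y ** E y)\<close> creates the
      commutator contained in \<open>\<rho>\<close>.\<close>
    moreover have "\<Omega> t ** Z y + \<Omega>' ** E y - (q y ** (\<Omega> t ** E y) + q' y ** E y)
        = \<Omega> t ** (Z y - q y ** E y) + \<rho> y ** E y"
      by (simp add: \<rho>_def commutator_def matmul.diff_left matmul.add_left matmul.diff_right
          matrix_mul_assoc)
    ultimately show "((\<lambda>y. Z y - q y ** E y) has_vector_derivative
        \<Omega> t ** (Z y - q y ** E y) + \<rho> y ** E y) (at y within {0..1})"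
      by simp
    have "op_norm (\<rho> y) * op_norm (E y) \<le> B * 1"
      using B[OF y] E_le[OF y] \<open>0 \<le> B\<close> unfolding \<rho>_def by (intro mult_mono) auto
    then show "op_norm (\<rho> y ** E y) \<le> B"
      using op_norm_mult order_trans by fastforce
    show "((\<lambda>y. B * y) has_real_derivative B) (at y within {0..1})"
      using DERIV_cmult[OF DERIV_ident, of B y "{0..1}"] by simp
  qed (use skew t in auto)
  then have "op_norm (Z 1 - q 1 ** E 1) \<le> B"
    by (simp add: Z0 q0 matmul.zero_left)
  moreover have "((\<lambda>s. mat_exp (\<Omega> s)) has_vector_derivative
      q 1 ** mat_exp (\<Omega> t) + (Z 1 - q 1 ** E 1)) (at t within T)"
    using D by (simp add: E1)
  ultimately show ?thesis by (rule that)
qed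

text \<open>\<open>\<tau>\<close> may exceed the length of the interval: inner integrals run only up
  to \<open>s\<close> but are estimated by the outer length \<open>t - a\<close>, so iterated bounds
  become plain powers of \<open>t - a\<close>.\<close>

lemma op_norm_initial_integral_le:
  fixes f :: "real \<Rightarrow> complex^'n^'n" and L :: "complex^'n^'n \<Rightarrow> complex^'n^'n"
  assumes "t \<in> {a..b}" "continuous_on {a..b} f" "bounded_linear L" "0 \<le> B" "t - a \<le> \<tau>"
    and "\<And>s. s \<in> {a..t} \<Longrightarrow> op_norm (L (f s)) \<le> B"
  shows "op_norm (L (integral {a..t} f)) \<le> B * \<tau>"
proof -
  have "op_norm (L (integral {a..t} f)) \<le> B * (t - a)"
    using assms by (intro op_norm_integral_le) (auto elim: continuous_on_subset)
  also have "\<dots> \<le> B * \<tau>"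
    using assms by (intro mult_left_mono) auto
  finally show ?thesis .
qed

section \<open>The Magnus data \<open>I\<close>, \<open>G\<close> and \<open>K\<close>: derivatives
  and skewness\<close>

locale magnus =
  fixes H :: "real \<Rightarrow> complex^'n^'n" and a b \<alpha> \<beta> :: real
  assumes ab: "a \<le> b"
    and H: "continuous_on {a..b} H"
    and herm: "\<And>t. t \<in> {a..b} \<Longrightarrow> hermitian (H t)"
    and \<alpha>: "\<And>\<sigma> s t. \<sigma> \<in> {a..b} \<Longrightarrow> s \<in> {a..b} \<Longrightarrow> t \<in> {a..b} \<Longrightarrow>
      op_norm (commutator (commutator (H \<sigma>) (H s)) (H t)) \<le> \<alpha>"
    and \<beta>: "\<And>\<sigma> s t \<tau>. \<sigma> \<in> {a..b} \<Longrightarrow> s \<in> {a..b} \<Longrightarrow> t \<in> {a..b} \<Longrightarrow> \<tau> \<in> {a..b} \<Longrightarrow>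
      op_norm (commutator (commutator (H \<sigma>) (H s)) (commutator (H \<tau>) (H t))) \<le> \<beta>"
begin

definition I where "I t = integral {a..t} H"

definition G where "G s = commutator (I s) (H s)"

definition K where "K t = integral {a..t} G"

lemma \<alpha>_nonneg: "0 \<le> \<alpha>" and \<beta>_nonneg: "0 \<le> \<beta>"
  using ab by (auto intro: order_trans[OF op_norm_nonneg \<alpha>[of a a a]]
      order_trans[OF op_norm_nonneg \<beta>[of a a a a]])

lemma I_deriv: "t \<in> {a..b} \<Longrightarrow> (I has_vector_derivative H t) (at t within {a..b})"
  unfolding I_def by (rule integral_has_vector_derivative[OF H])

lemma continuous_G: "continuous_on {a..b} G"
proof -
  have "continuous_on {a..b} I"
    unfolding continuous_on_eq_continuous_within
    using has_vector_derivative_continuous[OF I_deriv] by blast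
  then show ?thesis
    unfolding G_def by (intro commutator.continuous_on H)
qed

lemma K_deriv: "t \<in> {a..b} \<Longrightarrow> (K has_vector_derivative G t) (at t within {a..b})"
  unfolding K_def by (rule integral_has_vector_derivative[OF continuous_G])

lemma Omega2_eq: "Omega2 H t a = (- \<i>) *\<^sub>C I t + (1/2) *\<^sub>R K t"
  by (simp add: Omega2_def I_def K_def G_def[abs_def])

lemma Omega2_deriv:
  "t \<in> {a..b} \<Longrightarrow> ((\<lambda>t. Omega2 H t a) has_vector_derivative
    (- \<i>) *\<^sub>C H t + (1/2) *\<^sub>R G t) (at t within {a..b})"
  unfolding Omega2_eq
  by (intro has_vector_derivative_add I_deriv K_deriv
      bounded_linear.has_vector_derivative[OF bounded_linear_cscale]
      bounded_linear.has_vector_derivative[OF bounded_linear_scaleR_right])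

lemma skew_I: "t \<in> {a..b} \<Longrightarrow> skew ((- \<i>) *\<^sub>C I t)"
proof -
  assume t: "t \<in> {a..b}"
  have H': "H integrable_on {a..t}"
    by (rule integrable_continuous_real) (rule continuous_on_subset[OF H], use t in auto)
  have "skew (integral {a..t} (\<lambda>s. (- \<i>) *\<^sub>C H s))"
    using integrable_linear[OF H' bounded_linear_cscale] t
    by (intro skew_integral skew_hermitian herm) (auto simp: o_def)
  then show ?thesis
    using integral_linear[OF H' bounded_linear_cscale, of "- \<i>"] by (simp add: I_def o_def)
qed

text \<open>A commutator of Hermitian matrices is skew. Passing to the skew matrices
  \<open>-iI\<close> and \<open>-iH\<close> multiplies it by the square of \<open>-i\<close>, hence
  the factor \<open>-1\<close>.\<close>

lemma skew_G: "t \<in> {a..b} \<Longrightarrow> skew (G t)"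
proof -
  assume t: "t \<in> {a..b}"
  have "(- \<i>) *\<^sub>C (- \<i>) *\<^sub>C X = - X" for X :: "complex^'n^'n"
    by (simp add: cscale_def vec_eq_iff)
  then have "G t = (-1) *\<^sub>R commutator ((- \<i>) *\<^sub>C I t) ((- \<i>) *\<^sub>C H t)"
    by (simp add: G_def cscale_commutator_left cscale_commutator_right)
  also have "skew \<dots>"
    by (intro skew_scaleR skew_commutator skew_I skew_hermitian herm t)
  finally show "skew (G t)" .
qed

lemma skew_Omega2: "t \<in> {a..b} \<Longrightarrow> skew (Omega2 H t a)"
proof -
  assume t: "t \<in> {a..b}"
  have "G integrable_on {a..t}"
    by (rule integrable_continuous_real) (rule continuous_on_subset[OF continuous_G], use t in auto)
  then have "skew (K t)"
    unfolding K_def using t by (intro skew_integral skew_G) auto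
  then show "skew (Omega2 H t a)"
    unfolding Omega2_eq by (intro skew_add skew_I skew_scaleR t)
qed

section \<open>Commutator estimates by iterated integration\<close>

lemma commutator_K_H:
  assumes t: "t \<in> {a..b}"
  shows "op_norm (commutator (K t) (H t)) \<le> \<alpha> * (t - a) * (t - a)"
  unfolding K_def
\<comment> \<open>The commutator is a double integral of \<open>[[H \<sigma>, H s], H t]\<close>
  over \<open>a \<le> \<sigma> \<le> s \<le> t\<close>; each integration contributes one factor
  \<open>t - a\<close>.\<close>
proof (rule op_norm_initial_integral_le[where L = "\<lambda>Y. commutator Y (H t)", OF t continuous_G])
  fix s assume s: "s \<in> {a..t}"
  show "op_norm (commutator (G s) (H t)) \<le> \<alpha> * (t - a)"
    unfolding G_def I_def
    by (rule op_norm_initial_integral_le[where L = "\<lambda>Y. commutator (commutator Y (H s)) (H t)", OF _ H])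
      (use s t \<alpha> \<alpha>_nonneg in \<open>auto intro: bounded_linear_compose[OF commutator.bounded_linear_left]
        commutator.bounded_linear_left\<close>)
qed (use t \<alpha>_nonneg in \<open>auto intro: commutator.bounded_linear_left\<close>)

text \<open>Both copies of \<open>I t\<close> integrate up to the same \<open>t\<close>, so this is
  the integral of \<open>[H s, [H \<sigma>, H t]]\<close> over a square.\<close>

lemma commutator_I_G:
  assumes t: "t \<in> {a..b}"
  shows "op_norm (commutator (I t) (G t)) \<le> \<alpha> * (t - a) * (t - a)"
  unfolding I_def
proof (rule op_norm_initial_integral_le[where L = "\<lambda>Y. commutator Y (G t)", OF t H])
  fix s assume s: "s \<in> {a..t}"
  \<comment> \<open>The bound by \<open>\<alpha>\<close> has the nested commutator in the first
    slot; swapping costs a sign, which the norm ignores.\<close>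
  have "op_norm (commutator (H s) (commutator (H \<sigma>) (H t))) \<le> \<alpha>" if "\<sigma> \<in> {a..t}" for \<sigma>
    using \<alpha>[of \<sigma> t s] s t that by (subst commutator_swap) auto
  then show "op_norm (commutator (H s) (G t)) \<le> \<alpha> * (t - a)"
    unfolding G_def I_def
    by (intro op_norm_initial_integral_le[where L = "\<lambda>Y. commutator (H s) (commutator Y (H t))", OF t H])
      (use \<alpha>_nonneg in \<open>auto intro: bounded_linear_compose[OF commutator.bounded_linear_right]
        commutator.bounded_linear_left\<close>)
qed (use t \<alpha>_nonneg in \<open>auto intro: commutator.bounded_linear_left\<close>)

text \<open>Two integrations come from \<open>K t\<close> and one from \<open>G t\<close>; the
  integrand is a commutator of two commutators, hence \<open>\<beta>\<close> with a third
  power.\<close>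

lemma commutator_K_G:
  assumes t: "t \<in> {a..b}"
  shows "op_norm (commutator (K t) (G t)) \<le> \<beta> * (t - a) * (t - a) * (t - a)"
  unfolding K_def
proof (rule op_norm_initial_integral_le[where L = "\<lambda>Y. commutator Y (G t)", OF t continuous_G])
  fix s assume s: "s \<in> {a..t}"
  have "op_norm (commutator (commutator (H \<sigma>) (H s)) (G t)) \<le> \<beta> * (t - a)"
    if "\<sigma> \<in> {a..s}" for \<sigma>
    unfolding G_def I_def
    by (rule op_norm_initial_integral_le[where L = "\<lambda>Y. commutator (commutator (H \<sigma>) (H s)) (commutator Y (H t))",
          OF t H])
      (use that s t \<beta> \<beta>_nonneg in \<open>auto intro: bounded_linear_compose[OF commutator.bounded_linear_right]
        commutator.bounded_linear_left\<close>)
  then show "op_norm (commutator (G s) (G t)) \<le> \<beta> * (t - a) * (t - a)"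
    unfolding G_def[of s] I_def
    by (intro op_norm_initial_integral_le[where L = "\<lambda>Y. commutator (commutator Y (H s)) (G t)", OF _ H])
      (use s t \<beta>_nonneg in \<open>auto intro: bounded_linear_compose[OF commutator.bounded_linear_left]
        commutator.bounded_linear_left\<close>)
qed (use t \<beta>_nonneg in \<open>auto intro: commutator.bounded_linear_left\<close>)

section \<open>The defect of \<open>U2\<close> in the propagator equation\<close>

lemma U2_derivative:
  assumes t: "t \<in> {a..b}"
  obtains R where "op_norm R \<le> \<alpha> * (t - a) ^ 2 + \<beta> / 4 * (t - a) ^ 3"
    and "((\<lambda>t. U2 H t a) has_vector_derivative (- \<i>) *\<^sub>C H t ** U2 H t a + R) (at t within {a..b})"
proof -
  define A where "A = (- \<i>) *\<^sub>C H t"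
  \<comment> \<open>The coefficient of \<open>G t\<close> solves \<open>c' = 1/2 - y\<close>,
    \<open>c 0 = 0\<close>: the \<open>1/2\<close> comes from \<open>\<Omega>'\<close>, the
    \<open>- y\<close> from the main part \<open>- G t\<close> of \<open>[\<Omega>, A]\<close>. It
    vanishes again at \<open>y = 1\<close>, so \<open>q 1 = A\<close>.\<close>
  define q where "q = (\<lambda>y. y *\<^sub>R A + ((y - y\<^sup>2) / 2) *\<^sub>R G t)"
  define q' where "q' = (\<lambda>y. A + ((1 - 2 * y) / 2) *\<^sub>R G t)"
  let ?\<Omega> = "Omega2 H t a"
  have q: "(q has_vector_derivative q' y) (at y within {0..1})" for y
  proof -
    have "((\<lambda>y. (y - y\<^sup>2) / 2) has_vector_derivative (1 - 2 * y) / 2) (at y within {0..1})"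
      unfolding has_real_derivative_iff_has_vector_derivative[symmetric]
      by (auto intro!: derivative_eq_intros)
    then have "(q has_vector_derivative 1 *\<^sub>R A + ((1 - 2 * y) / 2) *\<^sub>R G t) (at y within {0..1})"
      unfolding q_def
      by (intro has_vector_derivative_add has_vector_derivative_id
          bounded_linear.has_vector_derivative[OF bounded_linear_scaleR_left])
    then show ?thesis by (simp add: q'_def)
  qed
  have bnd: "op_norm (A + (1/2) *\<^sub>R G t + commutator ?\<Omega> (q y) - q' y)
      \<le> \<alpha> * (t - a) ^ 2 + \<beta> / 4 * (t - a) ^ 3" if y: "y \<in> {0..1}" for y
  proof -
    have "y - y\<^sup>2 \<le> 1"
      using y zero_le_power2[of y] unfolding atLeastAtMost_iff by linarith
    have ii: "(- \<i>) *\<^sub>C (- \<i>) *\<^sub>C X = - X" for X :: "complex^'n^'n"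
      by (simp add: cscale_def vec_eq_iff)
    have "commutator ?\<Omega> A = - G t + (1/2) *\<^sub>R commutator (K t) A"
      by (simp add: Omega2_eq A_def G_def commutator.add_left commutator.scaleR_left ii
          linear_add[OF linear_cscale] linear_scale[OF linear_cscale] cscale_commutator_left cscale_commutator_right)
    moreover have "commutator ?\<Omega> (q y)
        = y *\<^sub>R commutator ?\<Omega> A + ((y - y\<^sup>2) / 2) *\<^sub>R commutator ?\<Omega> (G t)"
      by (simp add: q_def commutator.add_right commutator.scaleR_right)
    ultimately have "A + (1/2) *\<^sub>R G t + commutator ?\<Omega> (q y) - q' y
        = (y / 2) *\<^sub>R commutator (K t) A + ((y - y\<^sup>2) / 2) *\<^sub>R commutator ?\<Omega> (G t)"
      by (simp add: q'_def diff_divide_distrib scaleR_diff_left scaleR_diff_right)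
    also have "op_norm \<dots> \<le> y / 2 * op_norm (commutator (K t) A)
        + (y - y\<^sup>2) / 2 * op_norm (commutator ?\<Omega> (G t))"
      using y by (intro order_trans[OF op_norm_add])
        (simp add: op_norm_scaleR power2_eq_square mult_left_le)
    \<comment> \<open>The crude bounds \<open>y \<le> 1\<close> and
      \<open>y - y\<^sup>2 \<le> 1\<close> suffice: two \<open>\<alpha>\<close> terms of weight
      \<open>1/2\<close> add up to \<open>\<alpha>\<close>, and \<open>\<beta>\<close> gets weight
      \<open>1/4\<close> because \<open>K\<close> enters \<open>\<Omega>\<close> with another factor
      \<open>1/2\<close>.\<close>
    also have "\<dots> \<le> 1 / 2 * op_norm (commutator (K t) A)
        + 1 / 2 * op_norm (commutator ?\<Omega> (G t))"
      using y by (intro add_mono mult_right_mono) (use \<open>y - y\<^sup>2 \<le> 1\<close> in auto)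
    also have "op_norm (commutator (K t) A) = op_norm (commutator (K t) (H t))"
      by (simp add: A_def cscale_commutator_right op_norm_cscale)
    also have "op_norm (commutator ?\<Omega> (G t))
        \<le> op_norm (commutator (I t) (G t)) + 1 / 2 * op_norm (commutator (K t) (G t))"
      unfolding Omega2_eq commutator.add_left
      by (rule order_trans[OF op_norm_add])
        (simp add: cscale_commutator_left commutator.scaleR_left op_norm_cscale op_norm_scaleR)
    finally show ?thesis
      using commutator_K_H[OF t] commutator_I_G[OF t] commutator_K_G[OF t]
      by (simp add: power2_eq_square power3_eq_cube mult.assoc add_divide_distrib)
  qed
  have q1: "q 1 = A" and q0: "q 0 = 0"
    by (simp_all add: q_def)
  obtain R where "op_norm R \<le> \<alpha> * (t - a) ^ 2 + \<beta> / 4 * (t - a) ^ 3"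
    "((\<lambda>s. mat_exp (Omega2 H s a)) has_vector_derivative q 1 ** mat_exp ?\<Omega> + R) (at t within {a..b})"
    using mat_exp_curve_generator[OF Omega2_deriv[OF t] skew_Omega2 t q0 q, folded A_def, OF _ bnd]
    by blast
  then show ?thesis
    by (intro that) (simp_all add: q1 A_def U2_def)
qed

text \<open>Both propagators start at the identity and share the skew generator \<open>-iH\<close>,
  so their difference grows only by the integrated defect.\<close>

lemma U2_error:
  "op_norm (U2 H b a - U_exact H b a) \<le> \<alpha> * (b - a) ^ 3 / 3 + \<beta> * (b - a) ^ 4 / 16"
proof -
  \<comment> \<open>The antiderivative of the defect bound that vanishes at
    \<open>a\<close>.\<close>
  define \<phi> where "\<phi> = (\<lambda>t. \<alpha> * (t - a) ^ 3 / 3 + \<beta> * (t - a) ^ 4 / 16)"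
  have "\<forall>t\<in>{a..b}. \<exists>R. op_norm R \<le> \<alpha> * (t - a) ^ 2 + \<beta> / 4 * (t - a) ^ 3 \<and>
      ((\<lambda>t. U2 H t a) has_vector_derivative (- \<i>) *\<^sub>C H t ** U2 H t a + R) (at t within {a..b})"
  proof
    fix t assume t: "t \<in> {a..b}"
    obtain R where "op_norm R \<le> \<alpha> * (t - a) ^ 2 + \<beta> / 4 * (t - a) ^ 3"
      "((\<lambda>t. U2 H t a) has_vector_derivative (- \<i>) *\<^sub>C H t ** U2 H t a + R) (at t within {a..b})"
      by (rule U2_derivative[OF t])
    then show "\<exists>R. op_norm R \<le> \<alpha> * (t - a) ^ 2 + \<beta> / 4 * (t - a) ^ 3 \<and>
      ((\<lambda>t. U2 H t a) has_vector_derivative (- \<i>) *\<^sub>C H t ** U2 H t a + R) (at t within {a..b})"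
      by blast
  qed
  \<comment> \<open>A defect is chosen separately at each \<open>t\<close>; the comparison asks for
    pointwise bounds on it.\<close>
  from bchoice[OF this] obtain R where
    R: "\<And>t. t \<in> {a..b} \<Longrightarrow> op_norm (R t) \<le> \<alpha> * (t - a) ^ 2 + \<beta> / 4 * (t - a) ^ 3"
    and U2: "\<And>t. t \<in> {a..b} \<Longrightarrow> ((\<lambda>t. U2 H t a) has_vector_derivative
      (- \<i>) *\<^sub>C H t ** U2 H t a + R t) (at t within {a..b})"
    by blast
  have "solves_propagator_ode H a b (\<lambda>t. U_exact H t a)"
    by (rule U_exact_solves[OF ab H])
  then have U0: "U_exact H a a = mat 1"
    and U: "\<And>t. t \<in> {a..b} \<Longrightarrow> ((\<lambda>t. U_exact H t a) has_vector_derivative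
      (- \<i>) *\<^sub>C H t ** U_exact H t a) (at t within {a..b})"
    by (auto simp: solves_propagator_ode_def cscale_matmul_left)
  have "op_norm (U2 H b a - U_exact H b a) \<le> op_norm (U2 H a a - U_exact H a a) + (\<phi> b - \<phi> a)"
  proof (rule skew_ode_op_norm_le[OF ab])
    fix t assume t: "t \<in> {a..b}"
    show "((\<lambda>t. U2 H t a - U_exact H t a) has_vector_derivative
        (- \<i>) *\<^sub>C H t ** (U2 H t a - U_exact H t a) + R t) (at t within {a..b})"
      using has_vector_derivative_diff[OF U2[OF t] U[OF t]]
      by (simp add: matmul.diff_right algebra_simps)
    show "skew ((- \<i>) *\<^sub>C H t)"
      by (rule skew_hermitian[OF herm[OF t]])
    show "(\<phi> has_real_derivative \<alpha> * (t - a) ^ 2 + \<beta> / 4 * (t - a) ^ 3) (at t within {a..b})"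
      unfolding \<phi>_def
      by (auto intro!: derivative_eq_intros simp: power2_eq_square power3_eq_cube field_simps)
  qed (rule R)
  moreover have "U2 H a a = mat 1"
    by (simp add: U2_def Omega2_def mat_exp_zero linear_0[OF linear_cscale])
  ultimately show ?thesis
    by (simp add: U0 \<phi>_def)
qed

end

section \<open>From the suprema to pointwise bounds, and the final constants\<close>

theorem theorem2:
  fixes H :: "real \<Rightarrow> complex^'n^'n" and tj tj1 \<alpha> \<beta> :: real
  assumes "tj < tj1"
    and "continuous_on {tj..tj1} H"
    and "\<And>t. t \<in> {tj..tj1} \<Longrightarrow> hermitian (H t)"
    and "(SUP (\<sigma>, s, t) \<in> {tj..tj1} \<times> {tj..tj1} \<times> {tj..tj1}.
            op_norm (commutator (commutator (H \<sigma>) (H s)) (H t))) \<le> \<alpha>"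
    and "(SUP (\<sigma>, s, t, \<tau>) \<in> {tj..tj1} \<times> {tj..tj1} \<times> {tj..tj1} \<times> {tj..tj1}.
            op_norm (commutator (commutator (H \<sigma>) (H s)) (commutator (H \<tau>) (H t)))) \<le> \<beta>"
  shows "op_norm (U_exact H tj1 tj - U2 H tj1 tj)
           \<le> 13/24 * (tj1 - tj) ^ 3 * \<alpha> + 5/48 * (tj1 - tj) ^ 4 * \<beta>"
proof -
  let ?T = "{tj..tj1}"
  \<comment> \<open>A real \<open>SUP\<close> is known to dominate the members of a set only if that
    set is bounded above. The bound \<open>m\<close> for the continuous \<open>H\<close> on the
    compact interval provides this.\<close>
  obtain c where "c > 0" and c: "\<And>A::complex^'n^'n. op_norm A \<le> c * norm A"
    using op_norm_le_norm by blast
  have "bounded (H ` ?T)"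
    by (intro compact_imp_bounded compact_continuous_image assms(2)) simp
  then obtain h where "\<And>t. t \<in> ?T \<Longrightarrow> norm (H t) \<le> h"
    unfolding bounded_iff by blast
  then have h: "op_norm (H t) \<le> c * h" if "t \<in> ?T" for t
    using c[of "H t"] mult_left_mono[of "norm (H t)" h c] \<open>c > 0\<close> that
    by (meson less_imp_le order_trans)
  define m where "m = c * h"
  have "0 \<le> m"
    unfolding m_def using assms(1) by (intro order_trans[OF op_norm_nonneg h[of tj]]) simp
  have comm: "op_norm (commutator A B) \<le> 2 * x * y"
    if "op_norm A \<le> x" "op_norm B \<le> y" "0 \<le> x" for A B :: "complex^'n^'n" and x y
    by (rule order_trans[OF op_norm_commutator]) (use that in \<open>intro mult_mono; simp\<close>)
  note hm = h[folded m_def]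
  interpret magnus H tj tj1 \<alpha> \<beta>
  proof
    fix \<sigma> s t assume st: "\<sigma> \<in> ?T" "s \<in> ?T" "t \<in> ?T"
    have "bdd_above ((\<lambda>(\<sigma>, s, t). op_norm (commutator (commutator (H \<sigma>) (H s)) (H t))) ` (?T \<times> ?T \<times> ?T))"
      using \<open>0 \<le> m\<close> by (intro bdd_aboveI2[of _ _ "2 * (2 * m * m) * m"]) (elim SigmaE, hypsubst, unfold prod.case, intro comm hm, auto)
    from order_trans[OF cSUP_upper[OF _ this, of "(\<sigma>, s, t)"] assms(4)] st
    show "op_norm (commutator (commutator (H \<sigma>) (H s)) (H t)) \<le> \<alpha>"
      by simp
  next
    fix \<sigma> s t \<tau> assume st: "\<sigma> \<in> ?T" "s \<in> ?T" "t \<in> ?T" "\<tau> \<in> ?T"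
    have "bdd_above ((\<lambda>(\<sigma>, s, t, \<tau>). op_norm (commutator (commutator (H \<sigma>) (H s))
        (commutator (H \<tau>) (H t)))) ` (?T \<times> ?T \<times> ?T \<times> ?T))"
      using \<open>0 \<le> m\<close>
      by (intro bdd_aboveI2[of _ _ "2 * (2 * m * m) * (2 * m * m)"]) (elim SigmaE, hypsubst, unfold prod.case, intro comm hm, auto)
    from order_trans[OF cSUP_upper[OF _ this, of "(\<sigma>, s, t, \<tau>)"] assms(5)] st
    show "op_norm (commutator (commutator (H \<sigma>) (H s)) (commutator (H \<tau>) (H t))) \<le> \<beta>"
      by simp
  qed (use assms in auto)
  have "op_norm (U_exact H tj1 tj - U2 H tj1 tj) = op_norm (U2 H tj1 tj - U_exact H tj1 tj)"
    using op_norm_minus[of "U2 H tj1 tj - U_exact H tj1 tj"] by simp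
  also have "\<dots> \<le> 1/3 * ((tj1 - tj) ^ 3 * \<alpha>) + 1/16 * ((tj1 - tj) ^ 4 * \<beta>)"
    using U2_error by (simp add: mult.commute)
  \<comment> \<open>Here \<open>1/3 = 8/24\<close> and \<open>1/16 = 3/48\<close>, and
    \<open>\<alpha>\<close> and \<open>\<beta>\<close> are nonnegative.\<close>
  also have "\<dots> \<le> 13/24 * ((tj1 - tj) ^ 3 * \<alpha>) + 5/48 * ((tj1 - tj) ^ 4 * \<beta>)"
    using assms(1) \<alpha>_nonneg \<beta>_nonneg by (intro add_mono mult_right_mono) auto
  finally show ?thesis by simp
qed

end
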